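(* For all integers $\ell\ge 0$ and $k\ge 3$, every graph $G$ that is both $(P_4+\ell P_1)$-free and $K_k$-free satisfies $$\chi(G)\le \ell^{k-2}+2\ell^{k-3}+3\ell^{k-4}+\cdots+(k-2)\ell+(k-1)=\sum_{i=1}^{k-1} i\,\ell^{k-1-i}.$$
   Context: All graphs are finite and simple. A graph is $F$-free if it has no induced subgraph isomorphic to $F$. $P_4$ is the path on four vertices, $P_4+\ell P_1$ is the disjoint union of $P_4$ with $\ell$ isolated vertices, and $K_k$ is the complete graph on $k$ vertices. $\chi(G)$ is the chromatic number (with the convention $\ell^0=1$). *)

theory Defs
  imports "Graph_Theory.Graph_Theory"
begin

text \<open>
  Finite simple graphs are the locale \<^locale>\<open>graph\<close>: finite symmetric digraphs without loops
  and parallel arcs, so each undirected edge is a pair of opposite arcs.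
\<close>

definition induced_free :: "('c,'d) pre_digraph \<Rightarrow> ('a,'b) pre_digraph \<Rightarrow> bool" where
  "induced_free F G \<longleftrightarrow> \<not> (\<exists>H. induced_subgraph H G \<and> digraph_iso F H)"

definition path_graph :: "nat \<Rightarrow> nat pair_pre_digraph" where
  "path_graph n = \<lparr> pverts = {..<n},
     parcs = {(i, j). i < n \<and> j < n \<and> (j = Suc i \<or> i = Suc j)} \<rparr>"

definition edgeless_graph :: "nat \<Rightarrow> nat pair_pre_digraph" where
  "edgeless_graph n = \<lparr> pverts = {..<n}, parcs = {} \<rparr>"

definition complete_graph :: "nat \<Rightarrow> nat pair_pre_digraph" where
  "complete_graph n = \<lparr> pverts = {..<n}, parcs = {(i, j). i < n \<and> j < n \<and> i \<noteq> j} \<rparr>"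

definition disjoint_union ::
  "'a pair_pre_digraph \<Rightarrow> 'b pair_pre_digraph \<Rightarrow> ('a + 'b) pair_pre_digraph" where
  "disjoint_union G H = \<lparr> pverts = pverts G <+> pverts H,
     parcs = map_prod Inl Inl ` parcs G \<union> map_prod Inr Inr ` parcs H \<rparr>"

definition proper_coloring :: "('a,'b) pre_digraph \<Rightarrow> nat \<Rightarrow> ('a \<Rightarrow> nat) \<Rightarrow> bool" where
  "proper_coloring G n c \<longleftrightarrow>
     c ` verts G \<subseteq> {..<n} \<and> (\<forall>u v. u \<rightarrow>\<^bsub>G\<^esub> v \<longrightarrow> c u \<noteq> c v)"

text \<open>
  The minimum is attained for every \<^locale>\<open>graph\<close>; see \<open>proper_coloring_exists\<close> below.
\<close>

definition chromatic_number :: "('a,'b) pre_digraph \<Rightarrow> nat" where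
  "chromatic_number G = (LEAST n. \<exists>c. proper_coloring G n c)"

lemma pair_graphI:
  assumes "finite (pverts G)" "parcs G \<subseteq> pverts G \<times> pverts G" "sym (parcs G)" "irrefl (parcs G)"
  shows "pair_graph G"
proof
  show "finite (parcs G)"
    using assms(1,2) by (meson finite_SigmaI finite_subset)
qed (use assms in \<open>auto simp: symmetric_def irrefl_def\<close>)

lemma pair_graph_path_graph: "pair_graph (path_graph n)"
  by (rule pair_graphI) (auto simp: path_graph_def sym_def irrefl_def)

lemma pair_graph_edgeless_graph: "pair_graph (edgeless_graph n)"
  by (rule pair_graphI) (auto simp: edgeless_graph_def sym_def irrefl_def)

lemma pair_graph_complete_graph: "pair_graph (complete_graph n)"
  by (rule pair_graphI) (auto simp: complete_graph_def sym_def irrefl_def)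

lemma complete_digraph_complete_graph: "complete_digraph n (with_proj (complete_graph n))"
  using pair_graph.pair_graphD_graph[OF pair_graph_complete_graph]
  by (auto simp: complete_digraph_def complete_graph_def)

lemma pair_graph_disjoint_union:
  assumes "pair_graph G" "pair_graph H"
  shows "pair_graph (disjoint_union G H)"
proof -
  interpret G: pair_graph G by fact
  interpret H: pair_graph H by fact
  show ?thesis
  proof (rule pair_graphI)
    show "finite (pverts (disjoint_union G H))"
      using G.pair_finite_verts H.pair_finite_verts by (simp add: disjoint_union_def)
    show "parcs (disjoint_union G H) \<subseteq> pverts (disjoint_union G H) \<times> pverts (disjoint_union G H)"
      by (auto simp: disjoint_union_def dest: G.wellformed' H.wellformed')
    show "sym (parcs (disjoint_union G H))"
      by (force simp: disjoint_union_def sym_def dest: G.arcs_symmetric H.arcs_symmetric)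
    show "irrefl (parcs (disjoint_union G H))"
      by (auto simp: disjoint_union_def irrefl_def dest: G.no_loops' H.no_loops')
  qed
qed

lemma proper_coloring_exists:
  assumes "graph G"
  shows "\<exists>c. proper_coloring G (card (verts G)) c"
proof -
  interpret graph G by fact
  obtain c where c: "bij_betw c (verts G) {..<card (verts G)}"
    using ex_bij_betw_finite_nat[OF finite_verts] by (auto simp: atLeast0LessThan)
  have "c u \<noteq> c v" if "u \<rightarrow>\<^bsub>G\<^esub> v" for u v
    using that c adj_in_verts[OF that] adj_not_same by (metis bij_betw_def inj_onD)
  then have "proper_coloring G (card (verts G)) c"
    using c by (auto simp: proper_coloring_def bij_betw_def)
  then show ?thesis by blast
qed

end

theory Submission
  imports Defs
begin

text \<open>
  Choose an independent set \<open>I\<close> of largest size subject to \<open>card I \<le> l\<close>. The vertices without a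
  neighbour in \<open>I\<close> induce a \<open>P\<^sub>4\<close>-free graph: if \<open>card I = l\<close> then a \<open>P\<^sub>4\<close> among them would give
  \<open>P\<^sub>4 + l P\<^sub>1\<close>, and otherwise they are just the independent set \<open>I\<close>. Such a graph has no clique of
  size \<open>k\<close>, hence needs at most \<open>k - 1\<close> colours. The remaining vertices are covered by the at most \<open>l\<close>
  neighbourhoods of the vertices of \<open>I\<close>, each of which has no clique of size \<open>k - 1\<close>. This gives the
  recurrence \<open>f k = l * f (k - 1) + (k - 1)\<close>, which the stated sum solves.
\<close>

section \<open>From vertex maps to induced subgraphs\<close>

lemma digraph_iso_induce_subgraph:
  assumes F: "pair_graph F" and G: "graph G"
    and inj: "inj_on f (pverts F)" and sub: "f ` pverts F \<subseteq> verts G"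
    and adj: "\<And>u v. u \<in> pverts F \<Longrightarrow> v \<in> pverts F \<Longrightarrow> (u, v) \<in> parcs F \<longleftrightarrow> f u \<rightarrow>\<^bsub>G\<^esub> f v"
  shows "digraph_iso (with_proj F) (G \<restriction> (f ` pverts F))"
proof -
  interpret F: pair_graph F by fact
  interpret G: graph G by fact
  \<comment> \<open>Arcs of \<open>G\<close> are abstract objects, so an isomorphism also needs an
    arc map: \<open>g\<close> recovers an arc from its pair of ends, and \<open>h\<close> sends an
    arc of \<open>F\<close> to the arc joining the images of its ends.\<close>
  define g where "g = inv_into (arcs G) (\<lambda>e. (tail G e, head G e))"
  define h where "h = (\<lambda>(u, v). g (f u, f v))"
  have g: "g (u, v) \<in> arcs G" "tail G (g (u, v)) = u" "head G (g (u, v)) = v"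
    if "u \<rightarrow>\<^bsub>G\<^esub> v" for u v
  proof -
    have uv: "(u, v) \<in> (\<lambda>e. (tail G e, head G e)) ` arcs G"
      using that by (simp add: arcs_ends_conv)
    show "g (u, v) \<in> arcs G" unfolding g_def using uv by (rule inv_into_into)
    have "(tail G (g (u, v)), head G (g (u, v))) = (u, v)"
      unfolding g_def using uv by (rule f_inv_into_f)
    then show "tail G (g (u, v)) = u" "head G (g (u, v)) = v" by auto
  qed
  have arc: "u \<in> pverts F" "v \<in> pverts F" "f u \<rightarrow>\<^bsub>G\<^esub> f v" if "(u, v) \<in> parcs F" for u v
    using that adj F.arc_fst_in_verts[OF that] F.arc_snd_in_verts[OF that] by auto
  have h: "h (u, v) \<in> arcs G" "tail G (h (u, v)) = f u" "head G (h (u, v)) = f v"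
    if "(u, v) \<in> parcs F" for u v
    using g[OF arc(3)[OF that]] by (simp_all add: h_def)
  define hom where
    "hom = \<lparr>iso_verts = f, iso_arcs = h, iso_head = head G, iso_tail = tail G\<rparr>"
  have "inj_on h (parcs F)"
  proof (rule inj_onI, safe)
    fix u v u' v' assume uv: "(u, v) \<in> parcs F" "(u', v') \<in> parcs F" and "h (u, v) = h (u', v')"
    then have "f u = f u'" "f v = f v'" using h by metis+
    with inj arc uv show "u = u'" "v = v'" by (meson inj_onD)+
  qed
  with inj h have "pre_digraph.digraph_isomorphism (with_proj F) hom"
    by (auto simp: pre_digraph.digraph_isomorphism_def hom_def F.wf_digraph)
  \<comment> \<open>Inducedness: reflection of adjacency puts every arc between image vertices over
    an arc of \<open>F\<close>, and absence of parallel arcs makes it equal to the arc chosen by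
    \<open>h\<close>.\<close>
  moreover have "h ` parcs F = {e \<in> arcs G. tail G e \<in> f ` pverts F \<and> head G e \<in> f ` pverts F}"
  proof (intro equalityI subsetI)
    fix e assume "e \<in> h ` parcs F"
    then show "e \<in> {e \<in> arcs G. tail G e \<in> f ` pverts F \<and> head G e \<in> f ` pverts F}"
      using h arc by auto
  next
    fix e assume "e \<in> {e \<in> arcs G. tail G e \<in> f ` pverts F \<and> head G e \<in> f ` pverts F}"
    then obtain u v where e: "e \<in> arcs G" and uv: "u \<in> pverts F" "v \<in> pverts F"
      "tail G e = f u" "head G e = f v" by auto
    then have "f u \<rightarrow>\<^bsub>G\<^esub> f v" by (metis G.in_arcs_imp_in_arcs_ends)
    then have "(u, v) \<in> parcs F" using adj uv by auto
    moreover from h[OF this] e uv have "h (u, v) = e"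
      by (auto intro!: G.no_multi_arcs simp: arc_to_ends_def)
    ultimately show "e \<in> h ` parcs F" by (metis imageI)
  qed
  then have "G \<restriction> (f ` pverts F) = app_iso hom (with_proj F)"
    by (simp add: app_iso_def hom_def induce_subgraph_def)
  ultimately show ?thesis by (auto simp: digraph_iso_def)
qed

text \<open>Reduces freeness to vertex maps that preserve and reflect adjacency, so that arc maps
  can be forgotten from here on.\<close>

lemma induced_free_no_embedding:
  assumes "induced_free (with_proj F) G" "pair_graph F" "graph G"
    and "inj_on f (pverts F)" "f ` pverts F \<subseteq> verts G"
    and "\<And>u v. u \<in> pverts F \<Longrightarrow> v \<in> pverts F \<Longrightarrow> (u, v) \<in> parcs F \<longleftrightarrow> f u \<rightarrow>\<^bsub>G\<^esub> f v"
  shows False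
proof -
  interpret graph G by fact
  have "induced_subgraph (G \<restriction> (f ` pverts F)) G"
    using assms(5) by (rule induced_induce)
  with digraph_iso_induce_subgraph[OF assms(2-)] assms(1) show False
    by (auto simp: induced_free_def)
qed

section \<open>Cliques, independent sets and colourings inside a fixed graph\<close>

definition clique :: "('a,'b) pre_digraph \<Rightarrow> 'a set \<Rightarrow> bool" where
  "clique G K \<longleftrightarrow> K \<subseteq> verts G \<and> (\<forall>u\<in>K. \<forall>v\<in>K. u \<noteq> v \<longrightarrow> u \<rightarrow>\<^bsub>G\<^esub> v)"

definition independent_set :: "('a,'b) pre_digraph \<Rightarrow> 'a set \<Rightarrow> bool" where
  "independent_set G I \<longleftrightarrow> I \<subseteq> verts G \<and> (\<forall>u\<in>I. \<forall>v\<in>I. \<not> u \<rightarrow>\<^bsub>G\<^esub> v)"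

text \<open>In a graph, symmetry and the absence of loops make these four vertices distinct.\<close>

definition induced_P4 :: "('a,'b) pre_digraph \<Rightarrow> 'a \<Rightarrow> 'a \<Rightarrow> 'a \<Rightarrow> 'a \<Rightarrow> bool" where
  "induced_P4 G a b c d \<longleftrightarrow> a \<rightarrow>\<^bsub>G\<^esub> b \<and> b \<rightarrow>\<^bsub>G\<^esub> c \<and> c \<rightarrow>\<^bsub>G\<^esub> d \<and>
     \<not> a \<rightarrow>\<^bsub>G\<^esub> c \<and> \<not> a \<rightarrow>\<^bsub>G\<^esub> d \<and> \<not> b \<rightarrow>\<^bsub>G\<^esub> d"

text \<open>Relative to a vertex set \<open>S\<close>, so that the inductions below range over
  subsets of one graph instead of changing the graph.\<close>

definition colorable :: "('a,'b) pre_digraph \<Rightarrow> 'a set \<Rightarrow> nat \<Rightarrow> bool" where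
  "colorable G S n \<longleftrightarrow>
     (\<exists>c. c ` S \<subseteq> {..<n} \<and> (\<forall>u\<in>S. \<forall>v\<in>S. u \<rightarrow>\<^bsub>G\<^esub> v \<longrightarrow> c u \<noteq> (c v :: nat)))"

lemma colorable_mono: "colorable G S m \<Longrightarrow> T \<subseteq> S \<Longrightarrow> m \<le> n \<Longrightarrow> colorable G T n"
  unfolding colorable_def by (meson image_mono lessThan_subset_iff order_trans subsetD)

lemma colorable_empty: "colorable G {} n"
  by (simp add: colorable_def)

lemma colorable_independent: "independent_set G I \<Longrightarrow> colorable G I 1"
  by (auto simp: colorable_def independent_set_def)

lemma colorable_Un:
  assumes "colorable G S m" "colorable G T n"
  shows "colorable G (S \<union> T) (m + n)"
proof -
  obtain c d where c: "c ` S \<subseteq> {..<m}" "\<forall>u\<in>S. \<forall>v\<in>S. u \<rightarrow>\<^bsub>G\<^esub> v \<longrightarrow> c u \<noteq> c v"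
    and d: "d ` T \<subseteq> {..<n}" "\<forall>u\<in>T. \<forall>v\<in>T. u \<rightarrow>\<^bsub>G\<^esub> v \<longrightarrow> d u \<noteq> d v"
    using assms by (auto simp: colorable_def)
  \<comment> \<open>The colours of \<open>T\<close> are shifted past those of \<open>S\<close>; on
    the overlap the colour from \<open>S\<close> is kept.\<close>
  let ?e = "\<lambda>x. if x \<in> S then c x else m + d x"
  have less: "c x < m" if "x \<in> S" for x using c(1) that by auto
  have "?e ` (S \<union> T) \<subseteq> {..<m + n}" using c(1) d(1) by fastforce
  moreover have "?e u \<noteq> ?e v" if "u \<in> S \<union> T" "v \<in> S \<union> T" "u \<rightarrow>\<^bsub>G\<^esub> v" for u v
    using that c(2) d(2) less[of u] less[of v] by auto
  ultimately show ?thesis unfolding colorable_def by blast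
qed

lemma colorable_UN:
  assumes "finite I" "\<And>i. i \<in> I \<Longrightarrow> colorable G (A i) n"
  shows "colorable G (\<Union>i\<in>I. A i) (card I * n)"
  using assms
  by (induction I rule: finite_induct) (auto intro: colorable_Un colorable_empty)

lemma chromatic_number_le:
  assumes "graph G" "colorable G (verts G) n"
  shows "chromatic_number G \<le> n"
proof -
  interpret graph G by fact
  obtain c where c: "c ` verts G \<subseteq> {..<n}"
    "\<And>u v. u \<in> verts G \<Longrightarrow> v \<in> verts G \<Longrightarrow> u \<rightarrow>\<^bsub>G\<^esub> v \<Longrightarrow> c u \<noteq> c v"
    using assms(2) unfolding colorable_def by blast
  have "proper_coloring G n c"
    unfolding proper_coloring_def using c adj_in_verts by simp
  then have "\<exists>c. proper_coloring G n c" by blast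
  then show ?thesis unfolding chromatic_number_def by (rule Least_le)
qed

section \<open>Colouring P4-free vertex sets\<close>

context graph
begin

lemma adj_commute: "u \<rightarrow> v \<longleftrightarrow> v \<rightarrow> u"
  by (metis graph_symmetric)

lemma finite_clique: "clique G K \<Longrightarrow> finite K"
  unfolding clique_def by (meson finite_subset finite_verts)

lemma finite_independent: "independent_set G I \<Longrightarrow> finite I"
  unfolding independent_set_def by (meson finite_subset finite_verts)

lemma clique_insert:
  assumes "clique G K" "x \<in> verts G" "\<And>y. y \<in> K \<Longrightarrow> x \<rightarrow> y"
  shows "clique G (insert x K)"
  using assms unfolding clique_def by (auto simp: adj_commute)

text \<open>In a largest independent set of size at most \<open>l\<close>, a size below
  \<open>l\<close> leaves room for one more vertex, so every outside vertex must have a neighbour in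
  it. A bound \<open>l\<close> out of reach yields a maximal independent set.\<close>

lemma obtain_saturated_independent:
  assumes "S \<subseteq> verts G"
  obtains I where "I \<subseteq> S" "independent_set G I" "card I \<le> l"
    "card I = l \<or> (\<forall>v\<in>S - I. \<exists>u\<in>I. u \<rightarrow> v)"
proof -
  let ?P = "\<lambda>I. I \<subseteq> S \<and> independent_set G I \<and> card I \<le> l"
  have "?P {}" by (simp add: independent_set_def)
  then have "\<exists>I. ?P I \<and> (\<forall>J. ?P J \<longrightarrow> card J \<le> card I)"
    by (rule ex_has_greatest_nat[where b = "Suc l"]) auto
  then obtain I where I: "?P I" and max: "\<And>J. ?P J \<Longrightarrow> card J \<le> card I"
    by blast
  have "\<exists>u\<in>I. u \<rightarrow> v" if "card I \<noteq> l" "v \<in> S - I" for v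
  proof (rule ccontr)
    assume "\<not> (\<exists>u\<in>I. u \<rightarrow> v)"
    then have "independent_set G (insert v I)"
      using I that assms adj_not_same adj_commute unfolding independent_set_def by blast
    moreover have "card (insert v I) = Suc (card I)"
      using that(2) finite_independent[of I] I by simp
    ultimately show False using max[of "insert v I"] that I by simp
  qed
  then show thesis using that I by blast
qed

text \<open>
  Take a vertex of \<open>I\<close> with the most neighbours in \<open>K\<close>. If it misses \<open>y \<in> K\<close>, then \<open>y\<close> has a
  neighbour \<open>z \<in> I\<close>, and by maximality some \<open>w \<in> K\<close> is adjacent to \<open>x\<close> but not to \<open>z\<close>; so
  \<open>x, w, y, z\<close> is an induced \<open>P\<^sub>4\<close>.
\<close>

lemma P4_free_clique_extension:
  assumes no_P4: "\<And>a b c d. {a, b, c, d} \<subseteq> S \<Longrightarrow> \<not> induced_P4 G a b c d"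
    and I: "I \<subseteq> S" "independent_set G I" "\<And>v. v \<in> S - I \<Longrightarrow> \<exists>u\<in>I. u \<rightarrow> v"
    and K: "K \<subseteq> S - I" "clique G K" "K \<noteq> {}"
  obtains x where "x \<in> I" "\<And>y. y \<in> K \<Longrightarrow> x \<rightarrow> y"
proof -
  let ?N = "\<lambda>x. {y \<in> K. x \<rightarrow> y}"
  have "I \<noteq> {}" using I(3) K(1,3) by blast
  then obtain x0 where "x0 \<in> I" by blast
  then have "\<exists>x. x \<in> I \<and> (\<forall>z. z \<in> I \<longrightarrow> card (?N z) \<le> card (?N x))"
    by (rule ex_has_greatest_nat[where b = "Suc (card K)"])
      (auto simp: less_Suc_eq_le intro!: card_mono finite_clique[OF K(2)])
  then obtain x where x: "x \<in> I" and max: "\<And>z. z \<in> I \<Longrightarrow> card (?N z) \<le> card (?N x)"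
    by blast
  have "x \<rightarrow> y" if y: "y \<in> K" for y
  proof (rule ccontr)
    assume xy: "\<not> x \<rightarrow> y"
    obtain z where z: "z \<in> I" "z \<rightarrow> y" using I(3) K(1) y by blast
    have "\<not> ?N x \<subset> ?N z"
      using max[OF z(1)] psubset_card_mono[of "?N z" "?N x"] finite_clique[OF K(2)] by auto
    then obtain w where w: "w \<in> K" "x \<rightarrow> w" "\<not> z \<rightarrow> w" using y z xy by blast
    have "w \<rightarrow> y" using K(2) w y xy by (auto simp: clique_def)
    moreover have "\<not> x \<rightarrow> z" using I(2) x z by (auto simp: independent_set_def)
    ultimately have "induced_P4 G x w y z"
      using w xy z adj_commute unfolding induced_P4_def by blast
    moreover have "{x, w, y, z} \<subseteq> S" using x z w y I(1) K(1) by auto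
    ultimately show False using no_P4 by blast
  qed
  with x that show thesis by blast
qed

text \<open>Removing a maximal independent set costs one colour and lowers the clique bound by one,
  because every nonempty clique outside it extends by one of its vertices. Excluding size
  \<open>Suc m\<close> excludes larger cliques too, as subsets of cliques are cliques.\<close>

lemma P4_free_colorable:
  assumes "S \<subseteq> verts G"
    and "\<And>a b c d. {a, b, c, d} \<subseteq> S \<Longrightarrow> \<not> induced_P4 G a b c d"
    and "\<And>K. K \<subseteq> S \<Longrightarrow> clique G K \<Longrightarrow> card K \<noteq> Suc m"
  shows "colorable G S m"
  using assms
proof (induction m arbitrary: S)
  case 0
  have "x \<notin> S" for x
    using "0.prems"(3)[of "{x}"] "0.prems"(1) by (auto simp: clique_def)
  then show ?case using colorable_empty[of G 0] by (metis ex_in_conv)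
next
  case (Suc m)
  have fin: "finite S" using Suc.prems(1) finite_verts by (rule finite_subset)
  \<comment> \<open>No subset of \<open>S\<close> has \<open>Suc (card S)\<close> elements, so the
    second alternative holds and \<open>I\<close> is a maximal independent set in
    \<open>S\<close>.\<close>
  obtain I where I: "I \<subseteq> S" "independent_set G I" "card I = Suc (card S) \<or> (\<forall>v\<in>S - I. \<exists>u\<in>I. u \<rightarrow> v)"
    using obtain_saturated_independent[OF Suc.prems(1), of "Suc (card S)"] by metis
  have dom: "\<exists>u\<in>I. u \<rightarrow> v" if "v \<in> S - I" for v
    using that I card_mono[OF fin I(1)] by auto
  have "colorable G (S - I) m"
  proof (rule Suc.IH)
    fix K assume K: "K \<subseteq> S - I" "clique G K"
    show "card K \<noteq> Suc m"
    proof
      assume card: "card K = Suc m"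
      then have "K \<noteq> {}" by auto
      then obtain x where x: "x \<in> I" "\<And>y. y \<in> K \<Longrightarrow> x \<rightarrow> y"
        using P4_free_clique_extension[OF Suc.prems(2) I(1,2) dom K] by metis
      have "clique G (insert x K)"
        using K(2) x I(1) Suc.prems(1) by (intro clique_insert) auto
      moreover have "card (insert x K) = Suc (Suc m)"
        using card K(1) x(1) fin finite_subset[of K S] by (subst card_insert_disjoint) auto
      ultimately show False using Suc.prems(3) K(1) x(1) I(1) by blast
    qed
  qed (use Suc.prems in auto)
  from colorable_Un[OF this colorable_independent[OF I(2)]]
  show ?case by (rule colorable_mono) auto
qed

section \<open>What the two forbidden subgraphs exclude\<close>

text \<open>The vertices of an induced \<open>P\<^sub>4\<close> are distinct and not isolated, so \<open>J\<close> avoids them.\<close>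

lemma P4_lP1_free_D:
  assumes "induced_free (with_proj (disjoint_union (path_graph 4) (edgeless_graph l))) G"
    and P: "induced_P4 G a b c d" and J: "independent_set G J" "card J = l"
  shows "\<exists>u\<in>J. u \<rightarrow> a \<or> u \<rightarrow> b \<or> u \<rightarrow> c \<or> u \<rightarrow> d"
proof (rule ccontr)
  assume *: "\<not> ?thesis"
  have finJ: "finite J" using J(1) by (rule finite_independent)
  obtain j where j: "bij_betw j {..<l} J"
    using ex_bij_betw_nat_finite[OF finJ] J(2) by (auto simp: atLeast0LessThan)
  have P': "a \<rightarrow> b" "b \<rightarrow> c" "c \<rightarrow> d" "b \<rightarrow> a" "c \<rightarrow> b" "d \<rightarrow> c"
    "\<not> a \<rightarrow> c" "\<not> a \<rightarrow> d" "\<not> b \<rightarrow> d" "\<not> c \<rightarrow> a" "\<not> d \<rightarrow> a" "\<not> d \<rightarrow> b"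
    using P adj_commute unfolding induced_P4_def by blast+
  have irr: "\<not> x \<rightarrow> x" for x using adj_not_same by blast
  have dist: "distinct [a, b, c, d]"
    using P' irr by auto
  have inV: "{a, b, c, d} \<subseteq> verts G" using P' adj_in_verts by auto
  have Jn: "\<not> u \<rightarrow> x" "\<not> x \<rightarrow> u" "u \<noteq> x" if "u \<in> J" "x \<in> {a, b, c, d}" for u x
  proof -
    show n: "\<not> u \<rightarrow> x" using * that by auto
    then show "\<not> x \<rightarrow> u" by (simp add: adj_commute)
    show "u \<noteq> x" using * that P' by auto
  qed
  define p where "p = (\<lambda>i. [a, b, c, d] ! i)"
  have four: "{..<4::nat} = {0, 1, 2, 3}" by auto
  have p: "p 0 = a" "p 1 = b" "p 2 = c" "p 3 = d" by (simp_all add: p_def)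
  have pin: "p i \<in> {a, b, c, d}" if "i < 4" for i
  proof -
    have "i \<in> {0, 1, 2, 3}" using that by auto
    then show ?thesis using p by auto
  qed
  have jin: "j i \<in> J" if "i < l" for i using j that by (auto simp: bij_betw_def)
  let ?F = "disjoint_union (path_graph 4) (edgeless_graph l)"
  \<comment> \<open>The embedding to be refuted: \<open>p\<close> lists the path and
    \<open>j\<close> enumerates \<open>J\<close> as the isolated vertices.\<close>
  let ?f = "case_sum p j"
  have verts: "pverts ?F = Inl ` {..<4} \<union> Inr ` {..<l}"
    by (auto simp: disjoint_union_def path_graph_def edgeless_graph_def)
  show False
  proof (rule induced_free_no_embedding[OF assms(1) _ graph_axioms, of ?f])
    show "pair_graph ?F"
      by (intro pair_graph_disjoint_union pair_graph_path_graph pair_graph_edgeless_graph)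
    have "inj_on p {..<4}" using dist p by (auto simp: four inj_on_def)
    moreover have "inj_on j {..<l}" using j by (simp add: bij_betw_def)
    moreover have "p i \<noteq> j i'" if "i < 4" "i' < l" for i i'
      using Jn(3)[OF jin[OF that(2)] pin[OF that(1)]] by simp
    ultimately show "inj_on ?f (pverts ?F)"
      unfolding verts by (fastforce simp: inj_on_def)
    show "?f ` pverts ?F \<subseteq> verts G"
      using pin jin inV J(1) unfolding verts independent_set_def by fastforce
  next
    fix u v assume uv: "u \<in> pverts ?F" "v \<in> pverts ?F"
    have arcs: "parcs ?F = map_prod Inl Inl ` parcs (path_graph 4)"
      by (simp add: disjoint_union_def edgeless_graph_def)
    have PP: "(i, i') \<in> parcs (path_graph 4) \<longleftrightarrow> p i \<rightarrow> p i'" if "i < 4" "i' < 4" for i i'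
    proof -
      have "i \<in> {0, 1, 2, 3}" "i' \<in> {0, 1, 2, 3}" using that by auto
      then show ?thesis using P' irr p by (auto simp: path_graph_def)
    qed
    have JJ: "\<not> j i \<rightarrow> j i'" if "i < l" "i' < l" for i i'
      using J(1) jin that by (auto simp: independent_set_def)
    have JP: "\<not> j i \<rightarrow> p i'" "\<not> p i' \<rightarrow> j i" if "i < l" "i' < 4" for i i'
      using Jn(1,2)[OF jin[OF that(1)] pin[OF that(2)]] by auto
    have PF: "(Inl i, Inl i') \<in> parcs ?F \<longleftrightarrow> (i, i') \<in> parcs (path_graph 4)"
      "(Inl i, Inr r) \<notin> parcs ?F" "(Inr r, w) \<notin> parcs ?F" for i i' r w
      unfolding arcs by auto
    from uv show "(u, v) \<in> parcs ?F \<longleftrightarrow> ?f u \<rightarrow> ?f v"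
      unfolding verts by (elim UnE imageE) (simp_all add: PF PP JJ JP)
  qed
qed

lemma complete_graph_free_D:
  assumes "induced_free (with_proj (complete_graph k)) G" "clique G K"
  shows "card K \<noteq> k"
proof
  assume k: "card K = k"
  have "finite K" using assms(2) by (rule finite_clique)
  then obtain f where f: "bij_betw f {..<k} K"
    using ex_bij_betw_nat_finite k by (metis atLeast0LessThan)
  then have f': "inj_on f {..<k}" "f ` {..<k} = K" by (auto simp: bij_betw_def)
  show False
  proof (rule induced_free_no_embedding[OF assms(1) pair_graph_complete_graph graph_axioms, of f])
    show "inj_on f (pverts (complete_graph k))" "f ` pverts (complete_graph k) \<subseteq> verts G"
      using f' assms(2) by (auto simp: complete_graph_def clique_def)
  next
    fix u v assume "u \<in> pverts (complete_graph k)" "v \<in> pverts (complete_graph k)"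
    then have uv: "u \<in> {..<k}" "v \<in> {..<k}" by (auto simp: complete_graph_def)
    then have "f u = f v \<longleftrightarrow> u = v" using f'(1) by (meson inj_onD)
    moreover have "f u \<in> K" "f v \<in> K" using f'(2) uv by auto
    ultimately show "(u, v) \<in> parcs (complete_graph k) \<longleftrightarrow> f u \<rightarrow> f v"
      using uv assms(2) adj_not_same by (auto simp: complete_graph_def clique_def)
  qed
qed

section \<open>The recurrence for the number of colours\<close>

text \<open>Here \<open>m\<close> stands for \<open>k - 1\<close>. Freeness is assumed of all of
  \<open>G\<close> while the clique bound concerns only \<open>S\<close>, so the induction
  hypothesis applies to neighbourhoods taken inside \<open>S\<close>.\<close>

lemma P4_lP1_free_colorable:
  assumes free: "induced_free (with_proj (disjoint_union (path_graph 4) (edgeless_graph l))) G"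
    and "S \<subseteq> verts G"
    and "\<And>K. K \<subseteq> S \<Longrightarrow> clique G K \<Longrightarrow> card K \<noteq> Suc m"
  shows "colorable G S (\<Sum>i = 1..m. i * l ^ (m - i))"
  using assms(2-)
proof (induction m arbitrary: S)
  case 0
  have "x \<notin> S" for x
    using "0.prems"(2)[of "{x}"] "0.prems"(1) by (auto simp: clique_def)
  then show ?case using colorable_empty by (metis ex_in_conv)
next
  case (Suc m)
  let ?s = "\<Sum>i = 1..m. i * l ^ (m - i)"
  obtain I where I: "I \<subseteq> S" "independent_set G I" "card I \<le> l"
    "card I = l \<or> (\<forall>v\<in>S - I. \<exists>u\<in>I. u \<rightarrow> v)"
    using obtain_saturated_independent[OF Suc.prems(1)] by metis
  define N where "N = (\<lambda>u. {v \<in> S. u \<rightarrow> v})"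
  define R where "R = {v \<in> S. \<forall>u\<in>I. \<not> u \<rightarrow> v}"
  \<comment> \<open>A clique among the neighbours of \<open>u\<close> grows by one when
    \<open>u\<close> is added, so the clique bound drops to that of the induction
    hypothesis.\<close>
  have "colorable G (N u) ?s" if u: "u \<in> I" for u
  proof (rule Suc.IH)
    fix K assume K: "K \<subseteq> N u" "clique G K"
    have "u \<notin> K" using K(1) adj_not_same by (auto simp: N_def)
    then have "card (insert u K) = Suc (card K)" using finite_clique[OF K(2)] by simp
    moreover have "clique G (insert u K)"
      using K u I(1) Suc.prems(1) by (intro clique_insert) (auto simp: N_def)
    moreover have "insert u K \<subseteq> S" using K(1) u I(1) by (auto simp: N_def)
    ultimately show "card K \<noteq> Suc m"
      using Suc.prems(2) by (metis Suc_inject)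
  qed (use Suc.prems in \<open>auto simp: N_def\<close>)
  then have "colorable G (\<Union>u\<in>I. N u) (card I * ?s)"
    by (rule colorable_UN[OF finite_independent[OF I(2)]])
  moreover have "colorable G R (Suc m)"
  proof (rule P4_free_colorable)
    fix a b c d assume R: "{a, b, c, d} \<subseteq> R"
    show "\<not> induced_P4 G a b c d"
    proof
      assume P: "induced_P4 G a b c d"
      from I(4) show False
      proof
        assume "card I = l"
        from P4_lP1_free_D[OF free P I(2) this] R show False by (auto simp: R_def)
      next
        assume "\<forall>v\<in>S - I. \<exists>u\<in>I. u \<rightarrow> v"
        then have "R \<subseteq> I" by (auto simp: R_def)
        with R P I(2) show False by (auto simp: induced_P4_def independent_set_def)
      qed
    qed
  next
    show "R \<subseteq> verts G" using Suc.prems(1) by (auto simp: R_def)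
    show "card K \<noteq> Suc (Suc m)" if "K \<subseteq> R" "clique G K" for K
      using Suc.prems(2)[OF _ that(2)] that(1) by (auto simp: R_def)
  qed
  ultimately have "colorable G ((\<Union>u\<in>I. N u) \<union> R) (card I * ?s + Suc m)"
    by (rule colorable_Un)
  \<comment> \<open>The top term \<open>i = Suc m\<close> carries \<open>l ^ 0 = 1\<close>, also for
    \<open>l = 0\<close>; every other term gains one factor \<open>l\<close>.\<close>
  moreover have "(\<Sum>i = 1..Suc m. i * l ^ (Suc m - i)) = l * ?s + Suc m"
    by (auto simp: sum_distrib_left Suc_diff_le intro!: sum.cong)
  moreover have "S \<subseteq> (\<Union>u\<in>I. N u) \<union> R" by (auto simp: N_def R_def)
  ultimately show ?case
    using I(3) by (simp add: colorable_mono)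
qed

end

theorem theorem5:
  fixes G :: "('a,'b) pre_digraph" and l k :: nat
  assumes "graph G"
    and "k \<ge> 3"
    and "induced_free (with_proj (disjoint_union (path_graph 4) (edgeless_graph l))) G"
    and "induced_free (with_proj (complete_graph k)) G"
  shows "chromatic_number G \<le> (\<Sum>i = 1..k - 1. i * l ^ (k - 1 - i))"
proof -
  interpret graph G by fact
  \<comment> \<open>The forbidden clique size \<open>Suc m\<close> for \<open>m = k - 1\<close> is
    \<open>k\<close>, since the truncated subtraction is exact for positive
    \<open>k\<close>.\<close>
  have "Suc (k - 1) = k" using assms(2) by simp
  then show ?thesis
    using complete_graph_free_D[OF assms(4)]
    by (intro chromatic_number_le[OF assms(1)] P4_lP1_free_colorable[OF assms(3)]) auto
qed

end
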